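(* If $G$ is the block-intersection graph of a BIBD$(v,k,1)$ with replication number $r = \frac{v-1}{k-1}$, then $\sigma(G) = k(r-1)$.
   Context: Surrounding Cops and Robbers on a finite simple graph $G$ with $k \geq 1$ cops and one robber: the cops first choose starting vertices (several cops may share a vertex), then the robber chooses a starting vertex not occupied by a cop, and thereafter the cops and the robber alternate moves, the cops moving first. In a move, each player may move to an adjacent vertex or stay put; the robber may never move to, or remain on, a vertex occupied by a cop, so if a cop moves onto the robber's vertex the robber is compelled to move to a neighbouring vertex not occupied by a cop. The cops win if at any time every neighbour of the robber's vertex is occupied by a cop; the robber wins if he avoids this forever. Play is with perfect information. The surrounding cop number $\sigma(G)$ is the least number of cops for which the cops have a winning strategy. For integers $v > k \geq 2$, a BIBD$(v,k,1)$ is a pair $(X,\mathcal{B})$ with $|X|=v$ and $\mathcal{B}$ a collection of $k$-subsets (blocks) of $X$ such that every 2-subset of $X$ lies in exactly one block; each point then lies in exactly $r=\frac{v-1}{k-1}$ blocks (the replication number). The block-intersection graph has vertex set $\mathcal{B}$, with two distinct blocks adjacent iff they have nonempty intersection. *)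

theory Defs
  imports Complex_Main "Graph_Theory.Pair_Digraph"
begin

text \<open>
  Finite simple graphs are represented as symmetric loop-free digraphs
  (\<^locale>\<open>pair_graph\<close>), an edge being a pair of opposite arcs.
\<close>

section \<open>Surrounding Cops and Robbers\<close>

text \<open>A placement of \<open>m\<close> cops is a function on \<open>nat\<close> of which only the values below \<open>m\<close> matter;
  it need not be injective.\<close>

definition occupied :: "nat \<Rightarrow> (nat \<Rightarrow> 'a) \<Rightarrow> 'a set" where
  "occupied m c = c ` {..<m}"

definition surrounded :: "'a pair_pre_digraph \<Rightarrow> nat \<Rightarrow> (nat \<Rightarrow> 'a) \<Rightarrow> 'a \<Rightarrow> bool" where
  "surrounded G m c u \<longleftrightarrow> (\<forall>w. (u, w) \<in> parcs G \<longrightarrow> w \<in> occupied m c)"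

definition legal_step :: "'a pair_pre_digraph \<Rightarrow> 'a \<Rightarrow> 'a \<Rightarrow> bool" where
  "legal_step G u w \<longleftrightarrow> w = u \<or> (u, w) \<in> parcs G"

text \<open>
  A strategy maps the list of robber positions seen so far (oldest first) to the next placement of
  the cops; on the empty list it gives their starting placement.  The robber's trajectory
  determines the whole history, since the earlier cop placements are given by the strategy itself.
  Legality is required after all lists, also those that are not legal robber trajectories; this is
  no restriction, as the cops may stay put there.
\<close>

definition cop_strategy ::
  "'a pair_pre_digraph \<Rightarrow> nat \<Rightarrow> ('a list \<Rightarrow> nat \<Rightarrow> 'a) \<Rightarrow> bool" where
  "cop_strategy G m S \<longleftrightarrow>
     (\<forall>i<m. S [] i \<in> pverts G) \<and>
     (\<forall>h u. \<forall>i<m. legal_step G (S h i) (S (h @ [u]) i))"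

definition cops_at :: "('a list \<Rightarrow> nat \<Rightarrow> 'a) \<Rightarrow> (nat \<Rightarrow> 'a) \<Rightarrow> nat \<Rightarrow> nat \<Rightarrow> 'a" where
  "cops_at S \<rho> n = S (map \<rho> [0..<n])"

text \<open>
  Round \<open>n\<close>: the cops stand at \<open>cops_at S \<rho> n\<close> and the robber chooses \<open>\<rho> n\<close>; then the cops move
  to \<open>cops_at S \<rho> (Suc n)\<close>.  They may move onto the robber's vertex \<open>\<rho> n\<close>, in which case the
  robber has to leave it.
\<close>

definition robber_play ::
  "'a pair_pre_digraph \<Rightarrow> nat \<Rightarrow> ('a list \<Rightarrow> nat \<Rightarrow> 'a) \<Rightarrow> (nat \<Rightarrow> 'a) \<Rightarrow> bool" where
  "robber_play G m S \<rho> \<longleftrightarrow>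
     \<rho> 0 \<in> pverts G \<and>
     (\<forall>n. \<rho> n \<notin> occupied m (cops_at S \<rho> n)) \<and>
     (\<forall>n. legal_step G (\<rho> n) (\<rho> (Suc n)))"

text \<open>The robber's vertex is inspected both after his own move and after the cops' move.\<close>

definition robber_evades ::
  "'a pair_pre_digraph \<Rightarrow> nat \<Rightarrow> ('a list \<Rightarrow> nat \<Rightarrow> 'a) \<Rightarrow> (nat \<Rightarrow> 'a) \<Rightarrow> bool" where
  "robber_evades G m S \<rho> \<longleftrightarrow>
     (\<forall>n. \<not> surrounded G m (cops_at S \<rho> n) (\<rho> n) \<and>
          \<not> surrounded G m (cops_at S \<rho> (Suc n)) (\<rho> n))"

text \<open>
  A robber who is not surrounded has an unoccupied neighbour, hence a legal move.  So every play in
  which the robber is never surrounded is infinite, except that he may find no unoccupied starting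
  vertex at all, which counts as a win for the cops.
\<close>

definition winning_cop_strategy ::
  "'a pair_pre_digraph \<Rightarrow> nat \<Rightarrow> ('a list \<Rightarrow> nat \<Rightarrow> 'a) \<Rightarrow> bool" where
  "winning_cop_strategy G m S \<longleftrightarrow>
     cop_strategy G m S \<and> \<not> (\<exists>\<rho>. robber_play G m S \<rho> \<and> robber_evades G m S \<rho>)"

definition surrounding_cop_number :: "'a pair_pre_digraph \<Rightarrow> nat" where
  "surrounding_cop_number G = (LEAST m. 1 \<le> m \<and> (\<exists>S. winning_cop_strategy G m S))"

text \<open>The least number exists for every nonempty finite graph.\<close>

lemma card_cops_win:
  fixes G :: "'a pair_pre_digraph"
  assumes "finite (pverts G)" "pverts G \<noteq> {}"
  shows "1 \<le> card (pverts G) \<and> (\<exists>S. winning_cop_strategy G (card (pverts G)) S)"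
proof
  show "1 \<le> card (pverts G)"
    using assms by (simp add: Suc_le_eq card_gt_0_iff)
  obtain c :: "nat \<Rightarrow> 'a" where c: "c ` {..<card (pverts G)} = pverts G"
    using ex_bij_betw_nat_finite[OF assms(1)]
    by (auto simp: bij_betw_def atLeast0LessThan)
  have "winning_cop_strategy G (card (pverts G)) (\<lambda>h. c)"
    using c
    by (auto simp: winning_cop_strategy_def cop_strategy_def legal_step_def robber_play_def
        occupied_def cops_at_def)
  then show "\<exists>S. winning_cop_strategy G (card (pverts G)) S" by blast
qed

section \<open>Block designs\<close>

text \<open>With index 1 and \<open>k \<ge> 2\<close> no block can be repeated, so the collection of blocks is a set.\<close>

definition bibd1 :: "'a set \<Rightarrow> 'a set set \<Rightarrow> nat \<Rightarrow> nat \<Rightarrow> bool" where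
  "bibd1 X \<B> v k \<longleftrightarrow>
     2 \<le> k \<and> k < v \<and> finite X \<and> card X = v \<and>
     (\<forall>A\<in>\<B>. A \<subseteq> X \<and> card A = k) \<and>
     (\<forall>P. P \<subseteq> X \<and> card P = 2 \<longrightarrow> (\<exists>!A. A \<in> \<B> \<and> P \<subseteq> A))"

definition block_intersection_graph :: "'a set set \<Rightarrow> 'a set pair_pre_digraph" where
  "block_intersection_graph \<B> =
     \<lparr>pverts = \<B>, parcs = {(A, B). A \<in> \<B> \<and> B \<in> \<B> \<and> A \<noteq> B \<and> A \<inter> B \<noteq> {}}\<rparr>"

lemma pair_graph_block_intersection_graph:
  assumes "finite \<B>"
  shows "pair_graph (block_intersection_graph \<B>)"
proof -
  have "finite {(A, B). A \<in> \<B> \<and> B \<in> \<B> \<and> A \<noteq> B \<and> A \<inter> B \<noteq> {}}"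
    by (rule finite_subset[of _ "\<B> \<times> \<B>"]) (use assms in auto)
  then show ?thesis
    using assms
    by unfold_locales (auto simp: block_intersection_graph_def symmetric_def sym_def)
qed

end

theory Submission
  imports Defs
begin

text \<open>
  Every block meets exactly \<open>k (r - 1)\<close> others, so fewer cops can never surround the robber, who
  then always has an unoccupied neighbour to move to.

  Conversely, let \<open>k (r - 1)\<close> cops start on the neighbourhood of a block \<open>R\<^sub>0\<close>.  The robber has to
  start at \<open>R\<^sub>0\<close>, where he is surrounded, or at a block \<open>R\<close> disjoint from \<open>R\<^sub>0\<close>.  In the latter case
  give a neighbour \<open>A\<close> of \<open>R\<^sub>0\<close> and a neighbour \<open>B \<noteq> A\<close> of \<open>R\<close> the weight
  \<open>card (A \<inter> B - R\<^sub>0 - R)\<close>, and the weight \<open>2 (k - 1)\<close> if \<open>A = B\<close>.  All row and column sums of this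
  matrix equal \<open>k (k - 1)\<close>, so by Hall's theorem its support contains a perfect matching, along
  which the cops move to the neighbourhood of \<open>R\<close> in a single step.
\<close>

section \<open>Hall's theorem and matchings in regular weighted bipartite graphs\<close>

text \<open>Halmos-Vaughan induction on \<open>card I\<close>. If some nonempty proper
  \<open>J\<close> is tight, \<open>J\<close> is matched inside its neighbourhood \<open>U\<close>
  and the other indices outside \<open>U\<close>. If none is tight, every nonempty proper subfamily
  has an element to spare, so one pair may be fixed arbitrarily.\<close>

theorem hall_marriage:
  assumes "finite I"
    and "\<And>i. i \<in> I \<Longrightarrow> finite (F i)"
    and "\<And>J. J \<subseteq> I \<Longrightarrow> card J \<le> card (\<Union> (F ` J))"
  shows "\<exists>f. inj_on f I \<and> (\<forall>i\<in>I. f i \<in> F i)"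
  using assms
proof (induction "card I" arbitrary: I F rule: less_induct)
  case less
  note finI = less.prems(1) and finF = less.prems(2) and hall = less.prems(3)
  show ?case
  proof (cases "\<exists>J. J \<subset> I \<and> J \<noteq> {} \<and> card (\<Union> (F ` J)) = card J")
    case True
    then obtain J where J: "J \<subset> I" "J \<noteq> {}" "card (\<Union> (F ` J)) = card J" by blast
    have finJ: "finite J" using J(1) finI finite_subset by blast
    define U where "U = \<Union> (F ` J)"
    have finU: "finite U" using finJ finF J(1) unfolding U_def by blast
    have "\<exists>f. inj_on f J \<and> (\<forall>i\<in>J. f i \<in> F i)"
    proof (rule less.hyps)
      show "card J < card I" using J(1) finI by (simp add: psubset_card_mono)
    qed (use J(1) finJ finF hall in auto)
    then obtain f where f: "inj_on f J" "\<forall>i\<in>J. f i \<in> F i" by blast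
    have "\<exists>g. inj_on g (I - J) \<and> (\<forall>i\<in>I - J. g i \<in> F i - U)"
    proof (rule less.hyps)
      show "card (I - J) < card I"
        using J(1,2) finI by (intro psubset_card_mono) auto
      show "finite (I - J)" using finI by simp
      show "finite (F i - U)" if "i \<in> I - J" for i using that finF by simp
      fix K assume K: "K \<subseteq> I - J"
      have finK: "finite K" using K finI finite_subset by blast
      \<comment> \<open>Hall's inequality for \<open>J \<union> K\<close>: as
        \<open>card U = card J\<close>, cancelling leaves the condition for \<open>K\<close> with
        \<open>U\<close> deleted.\<close>
      have "card J + card K = card (J \<union> K)"
        using K finJ finK by (subst card_Un_disjoint) auto
      also have "\<dots> \<le> card (\<Union> (F ` (J \<union> K)))"
        using K J(1) by (intro hall) auto
      also have "\<Union> (F ` (J \<union> K)) = U \<union> (\<Union>i\<in>K. F i - U)"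
        unfolding U_def by auto
      also have "card \<dots> \<le> card U + card (\<Union>i\<in>K. F i - U)"
        by (rule card_Un_le)
      finally show "card K \<le> card (\<Union>i\<in>K. F i - U)"
        using J(3) unfolding U_def by simp
    qed
    then obtain g where g: "inj_on g (I - J)" "\<forall>i\<in>I - J. g i \<in> F i - U" by blast
    define h where "h i = (if i \<in> J then f i else g i)" for i
    have fU: "f i \<in> U" if "i \<in> J" for i using f(2) that unfolding U_def by blast
    have gU: "g i \<notin> U" if "i \<in> I" "i \<notin> J" for i using g(2) that by blast
    have "inj_on h I"
    proof (rule inj_onI)
      fix x y assume xy: "x \<in> I" "y \<in> I" "h x = h y"
      show "x = y"
      proof (cases "x \<in> J \<longleftrightarrow> y \<in> J")
        case True
        then show ?thesis using xy inj_onD[OF f(1)] inj_onD[OF g(1)] unfolding h_def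
          by (auto split: if_splits)
      next
        case False
        then show ?thesis using xy fU gU unfolding h_def by (metis (full_types))
      qed
    qed
    moreover have "\<forall>i\<in>I. h i \<in> F i" using f(2) g(2) unfolding h_def by auto
    ultimately show ?thesis by blast
  next
    case False
    show ?thesis
    proof (cases "I = {}")
      case True
      then show ?thesis by simp
    next
      case False': False
      then obtain i where i: "i \<in> I" by blast
      have "card {i} \<le> card (\<Union> (F ` {i}))" using i by (intro hall) auto
      then have "F i \<noteq> {}" by auto
      then obtain x where x: "x \<in> F i" by blast
      have "\<exists>g. inj_on g (I - {i}) \<and> (\<forall>j\<in>I - {i}. g j \<in> F j - {x})"
      proof (rule less.hyps)
        show "card (I - {i}) < card I" using i finI by (meson card_Diff1_less)
        show "finite (I - {i})" using finI by simp
        show "finite (F j - {x})" if "j \<in> I - {i}" for j using that finF by simp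
        fix K assume K: "K \<subseteq> I - {i}"
        show "card K \<le> card (\<Union>j\<in>K. F j - {x})"
        proof (cases "K = {}")
          case Kne: False
          have "card K \<le> card (\<Union> (F ` K))" using K by (intro hall) auto
          \<comment> \<open>\<open>K\<close> is proper because it misses \<open>i\<close>, hence not
            tight; the strict inequality pays for the deletion of \<open>x\<close>.\<close>
          moreover have "card (\<Union> (F ` K)) \<noteq> card K" using False K Kne i by blast
          ultimately have "card K < card (\<Union> (F ` K))" by simp
          moreover have "card (\<Union> (F ` K)) - 1 \<le> card (\<Union> (F ` K) - {x})"
            using diff_card_le_card_Diff[of "{x}" "\<Union> (F ` K)"] by simp
          moreover have "card (\<Union> (F ` K) - {x}) = card (\<Union>j\<in>K. F j - {x})"
            by (rule arg_cong[where f = card]) auto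
          ultimately show ?thesis by linarith
        qed simp
      qed
      then obtain g where g: "inj_on g (I - {i})" "\<forall>j\<in>I - {i}. g j \<in> F j - {x}" by blast
      have gx: "g j \<noteq> x" if "j \<in> I" "j \<noteq> i" for j using g(2) that by blast
      have "inj_on (g(i := x)) I"
        by (rule inj_onI) (use gx inj_onD[OF g(1)] in \<open>auto split: if_splits\<close>)
      moreover have "\<forall>j\<in>I. (g(i := x)) j \<in> F j" using g(2) x by auto
      ultimately show ?thesis by blast
    qed
  qed
qed

text \<open>The rows in \<open>J\<close> carry total weight \<open>d * card J\<close>, all of it in
  the columns \<open>U\<close> of their support, and each column holds only \<open>d\<close>. This
  is Hall's condition for the support.\<close>

lemma regular_weights_matching:
  fixes M :: "'a \<Rightarrow> 'b \<Rightarrow> nat"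
  assumes fin: "finite S" "finite T" and "0 < d"
    and rows: "\<And>a. a \<in> S \<Longrightarrow> (\<Sum>b\<in>T. M a b) = d"
    and cols: "\<And>b. b \<in> T \<Longrightarrow> (\<Sum>a\<in>S. M a b) = d"
  shows "\<exists>f. bij_betw f S T \<and> (\<forall>a\<in>S. 0 < M a (f a))"
proof -
  define F where "F a = {b\<in>T. 0 < M a b}" for a
  have "\<exists>f. inj_on f S \<and> (\<forall>a\<in>S. f a \<in> F a)"
  proof (rule hall_marriage)
    fix J assume J: "J \<subseteq> S"
    define U where "U = \<Union> (F ` J)"
    have U: "U \<subseteq> T" unfolding U_def F_def by auto
    have "d * card J = (\<Sum>a\<in>J. \<Sum>b\<in>T. M a b)" using rows J by (simp add: subset_iff)
    also have "\<dots> = (\<Sum>a\<in>J. \<Sum>b\<in>U. M a b)"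
      by (intro sum.cong refl sum.mono_neutral_right) (use fin U in \<open>auto simp: U_def F_def\<close>)
    also have "\<dots> = (\<Sum>b\<in>U. \<Sum>a\<in>J. M a b)" by (rule sum.swap)
    also have "\<dots> \<le> (\<Sum>b\<in>U. \<Sum>a\<in>S. M a b)"
      by (intro sum_mono sum_mono2) (use fin J in auto)
    also have "\<dots> = d * card U" using cols U by (simp add: subset_iff)
    finally show "card J \<le> card (\<Union> (F ` J))" using \<open>0 < d\<close> unfolding U_def by simp
  qed (use fin in \<open>auto simp: F_def\<close>)
  then obtain f where f: "inj_on f S" "\<forall>a\<in>S. f a \<in> F a" by blast
  \<comment> \<open>Comparing the total weight by rows and by columns makes both sides equally
    large, so the injection is onto.\<close>
  have "d * card S = (\<Sum>a\<in>S. \<Sum>b\<in>T. M a b)" using rows by simp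
  also have "\<dots> = (\<Sum>b\<in>T. \<Sum>a\<in>S. M a b)" by (rule sum.swap)
  also have "\<dots> = d * card T" using cols by simp
  finally have "card S = card T" using \<open>0 < d\<close> by simp
  moreover have "f ` S \<subseteq> T" using f(2) unfolding F_def by auto
  ultimately have "f ` S = T" using f(1) fin by (metis card_image card_subset_eq)
  then show ?thesis using f unfolding bij_betw_def F_def by blast
qed

section \<open>Designs\<close>

text \<open>Double counting of incidences between blocks and points, the engine of the counts
  below.\<close>

lemma sum_card_inter_eq_sum_degree:
  assumes "finite \<C>" "finite S"
  shows "(\<Sum>B\<in>\<C>. card (B \<inter> S)) = (\<Sum>a\<in>S. card {B\<in>\<C>. a \<in> B})"
proof -
  have "B \<inter> S = {a\<in>S. a \<in> B}" for B by auto
  then show ?thesis using sum_multicount_gen[OF assms, of "\<lambda>B a. a \<in> B"] by simp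
qed

locale design =
  fixes X :: "'a set" and \<B> :: "'a set set" and v k :: nat
  assumes bibd: "bibd1 X \<B> v k"
begin

lemma k_ge_2: "2 \<le> k" and k_less_v: "k < v" and finite_points: "finite X"
  and card_points: "card X = v"
  using bibd unfolding bibd1_def by auto

lemma block_subset: "A \<in> \<B> \<Longrightarrow> A \<subseteq> X" and card_block: "A \<in> \<B> \<Longrightarrow> card A = k"
  using bibd unfolding bibd1_def by auto

lemma finite_blocks: "finite \<B>"
  by (rule finite_subset[of _ "Pow X"]) (use block_subset finite_points in auto)

lemma finite_block: "A \<in> \<B> \<Longrightarrow> finite A"
  using finite_points block_subset finite_subset by blast

lemma ex1_block:
  assumes "x \<in> X" "y \<in> X" "x \<noteq> y"
  shows "\<exists>!A. A \<in> \<B> \<and> x \<in> A \<and> y \<in> A"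
proof -
  have "{x, y} \<subseteq> X \<and> card {x, y} = 2" using assms by simp
  then have "\<exists>!A. A \<in> \<B> \<and> {x, y} \<subseteq> A" using bibd unfolding bibd1_def by presburger
  then show ?thesis by simp
qed

lemma card_blocks_through_pair:
  assumes "x \<in> X" "y \<in> X" "x \<noteq> y"
  shows "card {A\<in>\<B>. x \<in> A \<and> y \<in> A} = 1"
proof -
  obtain A where "A \<in> \<B> \<and> x \<in> A \<and> y \<in> A" "\<And>B. B \<in> \<B> \<and> x \<in> B \<and> y \<in> B \<Longrightarrow> B = A"
    using ex1_block[OF assms] by (elim ex1E) blast
  then have "{A\<in>\<B>. x \<in> A \<and> y \<in> A} = {A}" by blast
  then show ?thesis by simp
qed

lemma block_eqI:
  assumes "A \<in> \<B>" "B \<in> \<B>" "x \<in> A" "x \<in> B" "y \<in> A" "y \<in> B" "x \<noteq> y"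
  shows "A = B"
proof -
  have "x \<in> X" "y \<in> X" using assms block_subset by auto
  then show ?thesis using ex1_block[of x y] assms by auto
qed

lemma card_inter_block:
  assumes "A \<in> \<B>" "B \<in> \<B>" "A \<noteq> B" "A \<inter> B \<noteq> {}"
  shows "card (A \<inter> B) = 1"
proof -
  obtain x where "x \<in> A \<inter> B" using assms by blast
  then have "A \<inter> B = {x}" using block_eqI[of A B x] assms by blast
  then show ?thesis by simp
qed

text \<open>Pairs of a block \<open>A\<close> through \<open>x\<close> and a further point
  \<open>y\<close> of \<open>A\<close>: each \<open>A\<close> contributes \<open>k - 1\<close> of
  them, each \<open>y\<close> exactly one.\<close>

lemma replication:
  assumes "x \<in> X"
  shows "(k - 1) * card {A\<in>\<B>. x \<in> A} = v - 1"
proof -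
  have "card (A \<inter> (X - {x})) = k - 1" if "A \<in> \<B>" "x \<in> A" for A
  proof -
    have "A \<inter> (X - {x}) = A - {x}" using block_subset that by blast
    then show ?thesis using that card_block by simp
  qed
  then have "(k - 1) * card {A\<in>\<B>. x \<in> A} = (\<Sum>A\<in>{A\<in>\<B>. x \<in> A}. card (A \<inter> (X - {x})))" by simp
  also have "\<dots> = (\<Sum>y\<in>X - {x}. card {A\<in>{A\<in>\<B>. x \<in> A}. y \<in> A})"
    using finite_blocks finite_points by (intro sum_card_inter_eq_sum_degree) auto
  also have "\<dots> = (\<Sum>y\<in>X - {x}. 1)"
    using card_blocks_through_pair[OF assms] by (intro sum.cong) auto
  also have "\<dots> = v - 1" using assms card_points finite_points by simp
  finally show ?thesis .
qed

text \<open>The replication number as a natural number; \<open>rep_mult\<close> shows that the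
  division is exact.\<close>

definition rep :: nat where "rep = (v - 1) div (k - 1)"

lemma card_blocks_through:
  assumes "x \<in> X"
  shows "card {A\<in>\<B>. x \<in> A} = rep"
  using replication[OF assms, symmetric] k_ge_2 unfolding rep_def by simp

lemma points_nonempty: "X \<noteq> {}"
  using card_points k_less_v by auto

lemma rep_mult: "(k - 1) * rep = v - 1"
proof -
  obtain x where "x \<in> X" using points_nonempty by blast
  then show ?thesis using replication[of x] card_blocks_through[of x] by simp
qed

text \<open>Otherwise \<open>v - 1 \<le> k - 1\<close>, against \<open>k < v\<close>. Hence blocks
  exist and \<open>k * (rep - 1)\<close> is positive.\<close>

lemma rep_ge_2: "2 \<le> rep"
proof (rule ccontr)
  assume "\<not> 2 \<le> rep"
  then have "(k - 1) * rep \<le> (k - 1) * 1" by (intro mult_le_mono2) simp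
  then show False using rep_mult k_less_v k_ge_2 by linarith
qed

lemma blocks_nonempty: "\<B> \<noteq> {}"
proof
  assume "\<B> = {}"
  obtain x where "x \<in> X" using points_nonempty by blast
  then show False using card_blocks_through[of x] rep_ge_2 \<open>\<B> = {}\<close> by simp
qed

section \<open>Neighbourhoods in the block-intersection graph\<close>

definition nbrs :: "'a set \<Rightarrow> 'a set set" where
  "nbrs A = {B\<in>\<B>. A \<noteq> B \<and> A \<inter> B \<noteq> {}}"

lemma finite_nbrs: "finite (nbrs A)"
  using finite_blocks unfolding nbrs_def by simp

lemma card_nbr_inter:
  assumes "A \<in> \<B>" "B \<in> nbrs A"
  shows "card (B \<inter> A) = 1"
  using card_inter_block[of B A] assms unfolding nbrs_def by auto

text \<open>Each neighbour meets \<open>A\<close> in a single point, and each point of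
  \<open>A\<close> lies on \<open>rep - 1\<close> blocks other than \<open>A\<close>.\<close>

lemma card_nbrs:
  assumes "A \<in> \<B>"
  shows "card (nbrs A) = k * (rep - 1)"
proof -
  have "card (nbrs A) = (\<Sum>B\<in>nbrs A. card (B \<inter> A))"
    using card_nbr_inter assms by simp
  also have "\<dots> = (\<Sum>x\<in>A. card {B\<in>nbrs A. x \<in> B})"
    using finite_nbrs finite_block assms by (intro sum_card_inter_eq_sum_degree)
  also have "\<dots> = (\<Sum>x\<in>A. rep - 1)"
  proof (intro sum.cong refl)
    fix x assume x: "x \<in> A"
    then have xX: "x \<in> X" using assms block_subset by blast
    have "{B\<in>nbrs A. x \<in> B} = {B\<in>\<B>. x \<in> B} - {A}"
      using x unfolding nbrs_def by auto
    then show "card {B\<in>nbrs A. x \<in> B} = rep - 1"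
      using x assms xX card_blocks_through[of x] by simp
  qed
  also have "\<dots> = k * (rep - 1)" using assms card_block by simp
  finally show ?thesis .
qed

text \<open>Each point of \<open>R\<close> is joined to \<open>a\<close> by one block, which differs
  from \<open>R\<close> since \<open>a \<notin> R\<close>. Different points of \<open>R\<close> give
  different blocks, as a neighbour meets \<open>R\<close> only once.\<close>

lemma card_nbrs_through:
  assumes "R \<in> \<B>" "a \<in> X" "a \<notin> R"
  shows "card {B\<in>nbrs R. a \<in> B} = k"
proof -
  have "card {B\<in>nbrs R. a \<in> B} = (\<Sum>B\<in>{B\<in>nbrs R. a \<in> B}. card (B \<inter> R))"
    using card_nbr_inter assms by simp
  also have "\<dots> = (\<Sum>y\<in>R. card {B\<in>{B\<in>nbrs R. a \<in> B}. y \<in> B})"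
    using finite_nbrs finite_block assms by (intro sum_card_inter_eq_sum_degree) auto
  also have "\<dots> = (\<Sum>y\<in>R. 1)"
  proof (intro sum.cong refl)
    fix y assume y: "y \<in> R"
    then have "{B\<in>{B\<in>nbrs R. a \<in> B}. y \<in> B} = {B\<in>\<B>. a \<in> B \<and> y \<in> B}"
      using assms unfolding nbrs_def by auto
    moreover have "y \<in> X" "a \<noteq> y" using y assms block_subset by auto
    ultimately show "card {B\<in>{B\<in>nbrs R. a \<in> B}. y \<in> B} = 1"
      using card_blocks_through_pair assms by simp
  qed
  also have "\<dots> = k" using assms card_block by simp
  finally show ?thesis .
qed

section \<open>The regular weight matrix between two neighbourhoods\<close>

text \<open>Let \<open>t = card (A \<inter> R)\<close>, which is 0 or 1. Then \<open>A'\<close> has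
  \<open>k - 1 - t\<close> points, each on \<open>k - t\<close> neighbours of \<open>R\<close> other
  than \<open>A\<close>. For \<open>t = 0\<close> the product is already \<open>k * (k - 1)\<close>;
  for \<open>t = 1\<close> it falls short by \<open>2 * (k - 1)\<close>, which is the weight chosen
  for \<open>A = B\<close>.\<close>

lemma sum_weights:
  assumes Q: "Q \<in> \<B>" and R: "R \<in> \<B>" and disj: "Q \<inter> R = {}" and A: "A \<in> nbrs Q"
  shows "(\<Sum>B\<in>nbrs R. if A = B then 2 * (k - 1) else card (A \<inter> B - Q - R)) = k * (k - 1)"
proof -
  define A' where "A' = A - Q - R"
  have AB: "A \<in> \<B>" "A \<noteq> Q" "Q \<inter> A \<noteq> {}" using A unfolding nbrs_def by auto
  have "A \<noteq> R" using AB(3) disj by auto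
  have finA: "finite A" using AB finite_block by blast
  have AQ: "card (A \<inter> Q) = 1" using card_nbr_inter[OF Q A] .
  have "A' = A - (A \<inter> Q \<union> A \<inter> R)" unfolding A'_def by auto
  then have "card A' = k - card (A \<inter> Q \<union> A \<inter> R)"
    using finA AB(1) card_block by (simp add: card_Diff_subset)
  also have "card (A \<inter> Q \<union> A \<inter> R) = 1 + card (A \<inter> R)"
    using finA disj AQ by (subst card_Un_disjoint) auto
  finally have cA': "card A' = k - 1 - card (A \<inter> R)" by simp
  have "(\<Sum>B\<in>nbrs R - {A}. card (A \<inter> B - Q - R)) = (\<Sum>B\<in>nbrs R - {A}. card (B \<inter> A'))"
    unfolding A'_def by (intro sum.cong refl arg_cong[where f = card]) auto
  also have "\<dots> = (\<Sum>a\<in>A'. card {B\<in>nbrs R - {A}. a \<in> B})"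
    using finite_nbrs finA unfolding A'_def by (intro sum_card_inter_eq_sum_degree) auto
  also have "\<dots> = (\<Sum>a\<in>A'. k - card (A \<inter> R))"
  proof (intro sum.cong refl)
    fix a assume a: "a \<in> A'"
    then have aX: "a \<in> X" "a \<notin> R" "a \<in> A" using AB(1) block_subset unfolding A'_def by auto
    have eq: "{B\<in>nbrs R - {A}. a \<in> B} = {B\<in>nbrs R. a \<in> B} - {A}" by auto
    \<comment> \<open>Of the \<open>k\<close> neighbours of \<open>R\<close> through
      \<open>a\<close>, the block \<open>A\<close> is one exactly when it meets
      \<open>R\<close>.\<close>
    show "card {B\<in>nbrs R - {A}. a \<in> B} = k - card (A \<inter> R)"
    proof (cases "A \<inter> R = {}")
      case True
      then have "A \<notin> nbrs R" unfolding nbrs_def by auto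
      then show ?thesis using eq True card_nbrs_through[OF R aX(1,2)] by simp
    next
      case False
      then have "A \<in> {B\<in>nbrs R. a \<in> B}" using AB \<open>A \<noteq> R\<close> aX unfolding nbrs_def by auto
      moreover have "card (A \<inter> R) = 1" using False card_inter_block AB R \<open>A \<noteq> R\<close> by blast
      ultimately show ?thesis using eq card_nbrs_through[OF R aX(1,2)] finite_nbrs
        by (simp add: card_Diff_singleton)
    qed
  qed
  finally have rest: "(\<Sum>B\<in>nbrs R - {A}. card (A \<inter> B - Q - R))
      = (k - 1 - card (A \<inter> R)) * (k - card (A \<inter> R))" using cA' by simp
  let ?w = "\<lambda>B. if A = B then 2 * (k - 1) else card (A \<inter> B - Q - R)"
  have rest': "(\<Sum>B\<in>nbrs R - {A}. ?w B) = (k - 1 - card (A \<inter> R)) * (k - card (A \<inter> R))"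
    unfolding rest[symmetric] by (intro sum.cong) auto
  show ?thesis
  proof (cases "A \<inter> R = {}")
    case True
    then have "A \<notin> nbrs R" unfolding nbrs_def by auto
    then show ?thesis using rest' True by (simp add: mult.commute)
  next
    case False
    then have "A \<in> nbrs R" using AB \<open>A \<noteq> R\<close> unfolding nbrs_def by auto
    then have "(\<Sum>B\<in>nbrs R. ?w B) = 2 * (k - 1) + (\<Sum>B\<in>nbrs R - {A}. ?w B)"
      by (subst sum.remove[OF finite_nbrs]) auto
    also have "card (A \<inter> R) = 1" using False card_inter_block AB R \<open>A \<noteq> R\<close> by blast
    with rest' have "(\<Sum>B\<in>nbrs R - {A}. ?w B) = (k - 2) * (k - 1)"
      by (simp add: numeral_2_eq_2)
    also have "2 * (k - 1) + (k - 2) * (k - 1) = (2 + (k - 2)) * (k - 1)"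
      by (simp only: add_mult_distrib)
    also have "2 + (k - 2) = k" using k_ge_2 by simp
    finally show ?thesis .
  qed
qed

lemma disjoint_blocks_matching:
  assumes "Q \<in> \<B>" "R \<in> \<B>" "Q \<inter> R = {}"
  shows "\<exists>f. bij_betw f (nbrs Q) (nbrs R) \<and> (\<forall>A\<in>nbrs Q. f A = A \<or> f A \<in> nbrs A)"
proof -
  define M where "M A B = (if A = B then 2 * (k - 1) else card (A \<inter> B - Q - R))" for A B
  \<comment> \<open>Transposing the matrix exchanges \<open>Q\<close> and \<open>R\<close>, so
    column sums are row sums of the same kind.\<close>
  have M_sym: "M A B = (if B = A then 2 * (k - 1) else card (B \<inter> A - R - Q))" for A B
    unfolding M_def by (auto intro: arg_cong[where f = card])
  have "\<exists>f. bij_betw f (nbrs Q) (nbrs R) \<and> (\<forall>A\<in>nbrs Q. 0 < M A (f A))"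
  proof (rule regular_weights_matching)
    show "0 < k * (k - 1)" using k_ge_2 by simp
    show "(\<Sum>B\<in>nbrs R. M A B) = k * (k - 1)" if "A \<in> nbrs Q" for A
      using sum_weights[OF assms that] unfolding M_def .
    show "(\<Sum>A\<in>nbrs Q. M A B) = k * (k - 1)" if "B \<in> nbrs R" for B
      using sum_weights[OF assms(2,1) _ that] assms(3) unfolding M_sym Int_commute[of R Q] by simp
  qed (rule finite_nbrs)+
  then obtain f where f: "bij_betw f (nbrs Q) (nbrs R)" "\<forall>A\<in>nbrs Q. 0 < M A (f A)" by blast
  have "f A = A \<or> f A \<in> nbrs A" if "A \<in> nbrs Q" for A
  proof -
    have "f A \<in> \<B>" using bij_betwE[OF f(1)] that unfolding nbrs_def by simp
    moreover have "A \<inter> f A \<noteq> {}" if "f A \<noteq> A"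
    proof
      assume "A \<inter> f A = {}"
      then have "M A (f A) = 0" using that unfolding M_def by auto
      then show False using bspec[OF f(2) \<open>A \<in> nbrs Q\<close>] by linarith
    qed
    ultimately show ?thesis unfolding nbrs_def by auto
  qed
  with f(1) show ?thesis by blast
qed

section \<open>The game on the block-intersection graph\<close>

abbreviation G :: "'a set pair_pre_digraph" where
  "G \<equiv> block_intersection_graph \<B>"

lemma surrounded_iff:
  "A \<in> \<B> \<Longrightarrow> surrounded G m c A \<longleftrightarrow> nbrs A \<subseteq> occupied m c"
  unfolding surrounded_def block_intersection_graph_def nbrs_def by auto

lemma legal_step_iff:
  "A \<in> \<B> \<Longrightarrow> legal_step G A B \<longleftrightarrow> B = A \<or> B \<in> nbrs A"
  unfolding legal_step_def block_intersection_graph_def nbrs_def by auto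

lemma pverts_G: "pverts G = \<B>"
  unfolding block_intersection_graph_def by simp

section \<open>Upper bound: surrounding after at most one cop move\<close>

lemma cops_win:
  "\<exists>S. winning_cop_strategy G (k * (rep - 1)) S"
proof -
  let ?m = "k * (rep - 1)"
  obtain Q where Q: "Q \<in> \<B>" using blocks_nonempty by blast
  obtain c where c: "bij_betw c {..<?m} (nbrs Q)"
    using ex_bij_betw_nat_finite[OF finite_nbrs, of Q] card_nbrs[OF Q]
    by (auto simp: atLeast0LessThan)
  have c_nbrs: "c i \<in> nbrs Q" if "i < ?m" for i using c that by (auto simp: bij_betw_def)
  have c_img: "c ` {..<?m} = nbrs Q" using c by (simp add: bij_betw_def)
  define P where "P R f \<longleftrightarrow> bij_betw f (nbrs Q) (nbrs R) \<and> (\<forall>A\<in>nbrs Q. f A = A \<or> f A \<in> nbrs A)"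
    for R f
  \<comment> \<open>The default \<open>id\<close> keeps the cops in place where no matching exists,
    because moves must be legal after every history.\<close>
  define F where "F R = (if \<exists>f. P R f then SOME f. P R f else id)" for R
  have F_step: "F R A = A \<or> F R A \<in> nbrs A" if "A \<in> nbrs Q" for R A
    using that someI_ex[of "P R"] unfolding F_def P_def by auto
  have F_img: "F R ` nbrs Q = nbrs R" if "R \<in> \<B>" "Q \<inter> R = {}" for R
    using disjoint_blocks_matching[OF Q that] someI_ex[of "P R"]
    unfolding F_def P_def bij_betw_def by auto
  \<comment> \<open>Only the robber's starting vertex \<open>hd h\<close> matters: the cops move
    once and then stand still.\<close>
  define S where "S h i = (if h = [] then c i else F (hd h) (c i))" for h :: "'a set list" and i
  have "cop_strategy G ?m S"
    unfolding cop_strategy_def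
  proof (intro conjI allI impI)
    fix i assume i: "i < ?m"
    then have ci: "c i \<in> \<B>" using c_nbrs unfolding nbrs_def by blast
    then show "S [] i \<in> pverts G" by (simp add: S_def pverts_G)
    fix h u
    show "legal_step G (S h i) (S (h @ [u]) i)"
    proof (cases h)
      case Nil
      then show ?thesis using F_step[OF c_nbrs[OF i]] ci by (simp add: S_def legal_step_iff)
    next
      case Cons
      then show ?thesis by (simp add: S_def legal_step_def)
    qed
  qed
  moreover have "\<not> robber_evades G ?m S \<rho>" if play: "robber_play G ?m S \<rho>" for \<rho>
  proof -
    have R: "\<rho> 0 \<in> \<B>" "\<rho> 0 \<notin> nbrs Q"
      using play c_img unfolding robber_play_def pverts_G
      by (auto simp: occupied_def cops_at_def S_def dest: spec[of _ 0])
    have occ0: "occupied ?m (cops_at S \<rho> 0) = nbrs Q"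
      using c_img by (simp add: occupied_def cops_at_def S_def)
    have "occupied ?m (cops_at S \<rho> (Suc 0)) = F (\<rho> 0) ` c ` {..<?m}"
      by (simp add: occupied_def cops_at_def S_def image_image)
    then have occ1: "occupied ?m (cops_at S \<rho> (Suc 0)) = F (\<rho> 0) ` nbrs Q"
      using c_img by simp
    \<comment> \<open>At \<open>Q\<close> the robber is surrounded before the cops move; elsewhere,
      immediately after their first move.\<close>
    have "surrounded G ?m (cops_at S \<rho> 0) (\<rho> 0) \<or> surrounded G ?m (cops_at S \<rho> (Suc 0)) (\<rho> 0)"
    proof (cases "\<rho> 0 = Q")
      case True
      then show ?thesis using occ0 R by (simp add: surrounded_iff)
    next
      case False
      then have "Q \<inter> \<rho> 0 = {}" using R unfolding nbrs_def by auto
      then show ?thesis using occ1 F_img R by (simp add: surrounded_iff)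
    qed
    then show ?thesis unfolding robber_evades_def by blast
  qed
  ultimately show ?thesis unfolding winning_cop_strategy_def by blast
qed

section \<open>Lower bound: the robber always finds a free neighbour\<close>

lemma few_cops_lose:
  assumes m: "m < k * (rep - 1)"
  shows "\<not> winning_cop_strategy G m S"
proof -
  have nsub: "\<not> nbrs A \<subseteq> occupied m c" if "A \<in> \<B>" for A c
  proof
    assume "nbrs A \<subseteq> occupied m c"
    then have "card (nbrs A) \<le> card (occupied m c)"
      by (intro card_mono) (simp_all add: occupied_def)
    also have "\<dots> \<le> m" unfolding occupied_def by (metis card_image_le card_lessThan finite_lessThan)
    finally show False using m card_nbrs[OF that] by simp
  qed
  obtain Q where Q: "Q \<in> \<B>" using blocks_nonempty by blast
  obtain A0 where A0: "A0 \<in> \<B>" "A0 \<notin> occupied m (S [])"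
    using nsub[OF Q, of "S []"] unfolding nbrs_def by blast
  \<comment> \<open>Dependent choice runs over histories, not positions, since \<open>S\<close>
    reads the whole history. \<open>h n\<close> lists the first \<open>n + 1\<close> positions, and
    \<open>S (butlast (h n))\<close> is the placement that the robber faces when choosing the last
    of them.\<close>
  have "\<exists>h. \<forall>n. (length (h n) = Suc n \<and> last (h n) \<in> \<B>
        \<and> last (h n) \<notin> occupied m (S (butlast (h n))) \<and> (n = 0 \<longrightarrow> h n = [A0]))
      \<and> (\<exists>B\<in>nbrs (last (h n)). h (Suc n) = h n @ [B])"
  proof (rule dependent_nat_choice)
    show "\<exists>h. length h = Suc 0 \<and> last h \<in> \<B> \<and> last h \<notin> occupied m (S (butlast h))
        \<and> (0 = (0::nat) \<longrightarrow> h = [A0])"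
      using A0 by (intro exI[of _ "[A0]"]) simp
    fix h :: "'a set list" and n
    assume h: "length h = Suc n \<and> last h \<in> \<B> \<and> last h \<notin> occupied m (S (butlast h))
        \<and> (n = 0 \<longrightarrow> h = [A0])"
    \<comment> \<open>The robber leaves his vertex in every round, so a cop landing on it does no
      harm.\<close>
    then obtain B where B: "B \<in> nbrs (last h)" "B \<notin> occupied m (S h)" using nsub by blast
    then have "B \<in> \<B>" unfolding nbrs_def by simp
    with h B show "\<exists>h'. (length h' = Suc (Suc n) \<and> last h' \<in> \<B>
        \<and> last h' \<notin> occupied m (S (butlast h')) \<and> (Suc n = 0 \<longrightarrow> h' = [A0]))
        \<and> (\<exists>B\<in>nbrs (last h). h' = h @ [B])"
      by (intro exI[of _ "h @ [B]"]) auto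
  qed
  then obtain h where h: "\<And>n. last (h n) \<in> \<B>" "\<And>n. last (h n) \<notin> occupied m (S (butlast (h n)))"
      "h 0 = [A0]" "\<And>n. \<exists>B\<in>nbrs (last (h n)). h (Suc n) = h n @ [B]"
    by blast
  define \<rho> where "\<rho> n = last (h n)" for n
  have step: "\<rho> (Suc n) \<in> nbrs (\<rho> n)" "h (Suc n) = h n @ [\<rho> (Suc n)]" for n
    using h(4)[of n] unfolding \<rho>_def by auto
  have "butlast (h n) = map \<rho> [0..<n] \<and> h n = map \<rho> [0..<Suc n]" for n
  proof (induction n)
    case 0
    then show ?case using h(3) by (simp add: \<rho>_def)
  next
    case (Suc n)
    then show ?case using step(2)[of n] by (simp add: butlast_append)
  qed
  then have "cops_at S \<rho> n = S (butlast (h n))" for n unfolding cops_at_def by simp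
  then have "robber_play G m S \<rho>"
    unfolding robber_play_def using h(1,2) step(1)
    by (auto simp: pverts_G legal_step_iff simp flip: \<rho>_def)
  moreover have "robber_evades G m S \<rho>"
    unfolding robber_evades_def using h(1) nsub by (simp add: surrounded_iff \<rho>_def)
  ultimately show ?thesis unfolding winning_cop_strategy_def by blast
qed

lemma surrounding_cop_number_eq: "surrounding_cop_number G = k * (rep - 1)"
  unfolding surrounding_cop_number_def
proof (rule Least_equality)
  show "1 \<le> k * (rep - 1) \<and> (\<exists>S. winning_cop_strategy G (k * (rep - 1)) S)"
    using cops_win k_ge_2 rep_ge_2 by simp
qed (use few_cops_lose not_le in blast)

end

theorem theorem25:
  fixes X :: "'a set" and \<B> :: "'a set set" and v k :: nat and r :: real
  assumes "bibd1 X \<B> v k"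
    and "r = (real v - 1) / (real k - 1)"
  shows "real (surrounding_cop_number (block_intersection_graph \<B>)) = real k * (r - 1)"
proof -
  interpret design X \<B> v k using assms(1) by unfold_locales
  \<comment> \<open>The exact division identifies the real quotient \<open>r\<close> with
    \<open>rep\<close>; \<open>rep_ge_2\<close> then lets \<open>rep - 1\<close> pass to the
    reals.\<close>
  have "(real k - 1) * real rep = real v - 1"
    using arg_cong[OF rep_mult, of real] k_ge_2 k_less_v by (simp add: of_nat_diff)
  moreover have "real k - 1 \<noteq> 0" using k_ge_2 by simp
  ultimately have "r = real rep" using assms(2) by (metis nonzero_mult_div_cancel_left)
  then show ?thesis
    unfolding surrounding_cop_number_eq using rep_ge_2 by (simp add: of_nat_diff)
qed

end
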